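(* Let $\Lambda$ be a $k$-graph with $1$-skeleton $E$, set of commuting squares $S$, augmented graph $E^+$ and cancellation relations $C$. Let $\mathcal G(\Lambda)$ be the fundamental groupoid of $\Lambda$ with canonical functor $i\colon\Lambda\to\mathcal G(\Lambda)$, and let $\Delta\colon E^+\to\mathcal P(E^+)/(C\cup S)$ be the canonical diagram of type $E^+$ satisfying $C\cup S$. Then there is a unique isomorphism $T\colon\mathcal G(\Lambda)\to\mathcal P(E^+)/(C\cup S)$ such that $T\circ i|_E=\Delta|_E$, where $i|_E$ is the restriction of $i$ to the vertices and edges of $E$ and $\Delta|_E$ is the restriction of $\Delta$ to the subgraph $E\subseteq E^+$.
   Context: Conventions for a small category $\mathbb C$: objects are identified with identity morphisms; $s(a)$, $r(a)$ denote domain (source) and codomain (range); composition is juxtaposition, $ab=a\circ b$ when $s(a)=r(b)$. A $k$-graph is a countable small category $\Lambda$ with a functor $d\colon\Lambda\to\mathbb N^k$ such that for all $\alpha\in\Lambda$ and $n,l\in\mathbb N^k$ with $d(\alpha)=n+l$ there are unique $\beta,\gamma$ with $d(\beta)=n$, $d(\gamma)=l$, $\alpha=\beta\gamma$. Write $\Lambda^0$ for objects, $\Lambda^n=d^{-1}(n)$, and $n_1,\dots,n_k$ for the standard basis of $\mathbb N^k$. The fundamental groupoid $\mathcal G(\Lambda)$ is the category of fractions $\Lambda[\Lambda^{-1}]$ together with the canonical functor $i\colon\Lambda\to\mathcal G(\Lambda)$: it is characterized (up to isomorphism) by $i(a)$ being invertible for all $a\in\Lambda$ and the universal property that every functor $F$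 from $\Lambda$ to a category in which all $F(a)$ are invertible factors uniquely as $F=F'\circ i$; it is a groupoid with the same objects as $\Lambda$, $i$ being the identity on objects. A graph $E=(E^0,E^1,r,s)$; a diagram of type $E$ in a category is a graph morphism into its underlying graph. $\mathcal P(E)$ is the path category (free category) on $E$, paths $e_1\cdots e_m$ written in composition order ($s(e_i)=r(e_{i+1})$). A relation for $E$ is a pair $(\alpha,\beta)$ of paths with common source and range; a diagram satisfies it if it sends $\alpha,\beta$ to the same morphism. For a set $K$ of relations, $\mathcal P(E)/K$ is the quotient of $\mathcal P(E)$ by the smallest equivalence relation containing $K$ compatible with composition (objects identified with $E^0$), and $\Delta\colon E\hookrightarrow\mathcal P(E)\to\mathcal P(E)/K$ is the canonical diagram of type $E$ satisfying $K$. The $1$-skeleton of $\Lambda$ is the graph $E$ with $E^0=\Lambda^0$, $E^1=\bigcup_{i=1}^k\Lambda^{n_i}$, range and source inherited from $\Lambda$. For composable $e,f\in E^1$ ($s(e)=r(f)$) with $d(e)\ne d(f)$ there are unique edges $g,h$ with $ef=gh$ in $\Lambda$, $d(g)=d(f)$, $d(h)=d(e)$; the relation $(ef,gh)$ is a commuting square, and $S$ is the set of all of them (regarded as relations for $E^+$). The augmented graph $E^+$ has vertex set $E^0$ and edge set $E^1\cup E^{-1}$, where $E^{-1}=\{e^{-1}: e\in E^1\}$ is a set of new edges with $s(e^{-1})=r(e)$, $r(e^{-1})=s(e)$; set $(e^{-1})^{-1}=e$. The cancellation relations are $C=\{(e^{-1}e,\,s(e)) : e\in E^1\cup E^{-1}\}$,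 where $s(e)$ denotes the empty path at $s(e)$. *)

theory Defs
  imports "HOL-Library.FuncSet" "HOL-Library.Countable_Set" "HOL-Library.Function_Algebras"
begin

section \<open>Categories and functors\<close>

text \<open>
  Categories are single-sorted: objects are identified with their identity morphisms, so
  domain and codomain are again morphisms. \<open>Comp C a b\<close> is \<open>a \<circ> b\<close>, meaningful when
  \<open>Dom C a = Cod C b\<close>.
\<close>

record 'a cat =
  Arr :: "'a set"
  Dom :: "'a \<Rightarrow> 'a"
  Cod :: "'a \<Rightarrow> 'a"
  Comp :: "'a \<Rightarrow> 'a \<Rightarrow> 'a"

locale category =
  fixes C :: "'a cat"
  assumes Dom_closed: "a \<in> Arr C \<Longrightarrow> Dom C a \<in> Arr C"
    and Cod_closed: "a \<in> Arr C \<Longrightarrow> Cod C a \<in> Arr C"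
    and Dom_Dom: "a \<in> Arr C \<Longrightarrow> Dom C (Dom C a) = Dom C a"
    and Cod_Dom: "a \<in> Arr C \<Longrightarrow> Cod C (Dom C a) = Dom C a"
    and Dom_Cod: "a \<in> Arr C \<Longrightarrow> Dom C (Cod C a) = Cod C a"
    and Cod_Cod: "a \<in> Arr C \<Longrightarrow> Cod C (Cod C a) = Cod C a"
    and Comp_closed: "\<lbrakk>a \<in> Arr C; b \<in> Arr C; Dom C a = Cod C b\<rbrakk> \<Longrightarrow> Comp C a b \<in> Arr C"
    and Dom_Comp: "\<lbrakk>a \<in> Arr C; b \<in> Arr C; Dom C a = Cod C b\<rbrakk> \<Longrightarrow> Dom C (Comp C a b) = Dom C b"
    and Cod_Comp: "\<lbrakk>a \<in> Arr C; b \<in> Arr C; Dom C a = Cod C b\<rbrakk> \<Longrightarrow> Cod C (Comp C a b) = Cod C a"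
    and Comp_Dom: "a \<in> Arr C \<Longrightarrow> Comp C a (Dom C a) = a"
    and Comp_Cod: "a \<in> Arr C \<Longrightarrow> Comp C (Cod C a) a = a"
    and Comp_assoc: "\<lbrakk>a \<in> Arr C; b \<in> Arr C; c \<in> Arr C; Dom C a = Cod C b; Dom C b = Cod C c\<rbrakk>
      \<Longrightarrow> Comp C (Comp C a b) c = Comp C a (Comp C b c)"

definition Obj :: "'a cat \<Rightarrow> 'a set" where
  "Obj C = {a \<in> Arr C. Dom C a = a}"

definition invertible_in :: "'a cat \<Rightarrow> 'a \<Rightarrow> bool" where
  "invertible_in C a \<longleftrightarrow> a \<in> Arr C \<and>
     (\<exists>b\<in>Arr C. Dom C b = Cod C a \<and> Cod C b = Dom C a \<and>
        Comp C b a = Dom C a \<and> Comp C a b = Cod C a)"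

text \<open>
  A functor is a function on morphisms. It is required to be \<open>undefined\<close> outside the
  source category, so that equality of functors is equality in HOL.
\<close>

definition is_functor :: "'a cat \<Rightarrow> 'b cat \<Rightarrow> ('a \<Rightarrow> 'b) \<Rightarrow> bool" where
  "is_functor C D F \<longleftrightarrow> F \<in> Arr C \<rightarrow>\<^sub>E Arr D \<and>
     (\<forall>a\<in>Arr C. F (Dom C a) = Dom D (F a)) \<and>
     (\<forall>a\<in>Arr C. F (Cod C a) = Cod D (F a)) \<and>
     (\<forall>a\<in>Arr C. \<forall>b\<in>Arr C. Dom C a = Cod C b \<longrightarrow> F (Comp C a b) = Comp D (F a) (F b))"

definition is_isomorphism :: "'a cat \<Rightarrow> 'b cat \<Rightarrow> ('a \<Rightarrow> 'b) \<Rightarrow> bool" where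
  "is_isomorphism C D F \<longleftrightarrow> is_functor C D F \<and>
     (\<exists>H. is_functor D C H \<and> (\<forall>a\<in>Arr C. H (F a) = a) \<and> (\<forall>b\<in>Arr D. F (H b) = b))"


section \<open>The fundamental groupoid\<close>

text \<open>
  HOL cannot quantify over types inside a formula, so the universal property of the category of
  fractions \<open>L[L\<^sup>-\<^sup>1]\<close> is relative to a type \<open>'x\<close> and speaks about
  all categories whose morphisms are elements of \<open>'x\<close>. Lemma
  \<open>is_fundamental_groupoid_fractions\<close> below provides, for every small category, one
  \<open>(G, i)\<close> that has the property at every type \<open>'x\<close>. Comparing two categories that
  satisfy it uses it only at the morphism types of these two categories.
\<close>

definition is_fundamental_groupoid ::
  "'x itself \<Rightarrow> 'a cat \<Rightarrow> 'g cat \<Rightarrow> ('a \<Rightarrow> 'g) \<Rightarrow> bool" where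
  "is_fundamental_groupoid _ L G i \<longleftrightarrow>
     category G \<and> is_functor L G i \<and> (\<forall>a\<in>Arr L. invertible_in G (i a)) \<and>
     (\<forall>(D :: 'x cat) F. category D \<and> is_functor L D F \<and> (\<forall>a\<in>Arr L. invertible_in D (F a)) \<longrightarrow>
        (\<exists>!F'. is_functor G D F' \<and> (\<forall>a\<in>Arr L. F' (i a) = F a)))"


section \<open>Quotient categories\<close>

inductive_set congruence_closure :: "'a cat \<Rightarrow> ('a \<times> 'a) set \<Rightarrow> ('a \<times> 'a) set"
  for C :: "'a cat" and K :: "('a \<times> 'a) set" where
  base: "(a, b) \<in> K \<Longrightarrow> (a, b) \<in> congruence_closure C K"
| refl: "a \<in> Arr C \<Longrightarrow> (a, a) \<in> congruence_closure C K"
| sym: "(a, b) \<in> congruence_closure C K \<Longrightarrow> (b, a) \<in> congruence_closure C K"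
| trans: "\<lbrakk>(a, b) \<in> congruence_closure C K; (b, c) \<in> congruence_closure C K\<rbrakk>
    \<Longrightarrow> (a, c) \<in> congruence_closure C K"
| comp: "\<lbrakk>(a, a') \<in> congruence_closure C K; (b, b') \<in> congruence_closure C K; Dom C a = Cod C b\<rbrakk>
    \<Longrightarrow> (Comp C a b, Comp C a' b') \<in> congruence_closure C K"

definition cong_class :: "'a cat \<Rightarrow> ('a \<times> 'a) set \<Rightarrow> 'a \<Rightarrow> 'a set" where
  "cong_class C K a = congruence_closure C K `` {a}"

text \<open>
  The unions below range over equal sets as soon as \<open>K\<close> consists of parallel pairs.
\<close>

definition quotient_cat :: "'a cat \<Rightarrow> ('a \<times> 'a) set \<Rightarrow> 'a set cat" where
  "quotient_cat C K = \<lparr>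
     Arr = Arr C // congruence_closure C K,
     Dom = (\<lambda>X. \<Union>a\<in>X. cong_class C K (Dom C a)),
     Cod = (\<lambda>X. \<Union>a\<in>X. cong_class C K (Cod C a)),
     Comp = (\<lambda>X Y. \<Union>a\<in>X. \<Union>b\<in>{b\<in>Y. Dom C a = Cod C b}. cong_class C K (Comp C a b)) \<rparr>"


section \<open>Graphs and path categories\<close>

record ('v, 'e) graph =
  Vert :: "'v set"
  Edge :: "'e set"
  Rng :: "'e \<Rightarrow> 'v"
  Src :: "'e \<Rightarrow> 'v"

text \<open>
  A path is a triple of its range, its list of edges in composition order, and its source; the
  empty path at \<open>v\<close> is \<open>(v, [], v)\<close>.
\<close>

type_synonym ('v, 'e) path = "'v \<times> 'e list \<times> 'v"

fun is_path :: "('v, 'e) graph \<Rightarrow> ('v, 'e) path \<Rightarrow> bool" where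
  "is_path E (v, [], w) \<longleftrightarrow> v \<in> Vert E \<and> v = w"
| "is_path E (v, e # es, w) \<longleftrightarrow> e \<in> Edge E \<and> Rng E e = v \<and> is_path E (Src E e, es, w)"

definition empty_path :: "'v \<Rightarrow> ('v, 'e) path" where
  "empty_path v = (v, [], v)"

definition path_cat :: "('v, 'e) graph \<Rightarrow> ('v, 'e) path cat" where
  "path_cat E = \<lparr>
     Arr = {p. is_path E p},
     Dom = (\<lambda>(v, es, w). empty_path w),
     Cod = (\<lambda>(v, es, w). empty_path v),
     Comp = (\<lambda>(v, es, w) (v', es', w'). (v, es @ es', w')) \<rparr>"

abbreviation path_cat_mod ::
  "('v, 'e) graph \<Rightarrow> (('v, 'e) path \<times> ('v, 'e) path) set \<Rightarrow> ('v, 'e) path set cat" where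
  "path_cat_mod E K \<equiv> quotient_cat (path_cat E) K"

text \<open>
  The vertex part and the edge part of the canonical diagram of type \<open>E\<close> in the path category
  modulo \<open>K\<close>.
\<close>

definition canonical_vert ::
  "('v, 'e) graph \<Rightarrow> (('v, 'e) path \<times> ('v, 'e) path) set \<Rightarrow> 'v \<Rightarrow> ('v, 'e) path set" where
  "canonical_vert E K v = cong_class (path_cat E) K (empty_path v)"

definition canonical_edge ::
  "('v, 'e) graph \<Rightarrow> (('v, 'e) path \<times> ('v, 'e) path) set \<Rightarrow> 'e \<Rightarrow> ('v, 'e) path set" where
  "canonical_edge E K e = cong_class (path_cat E) K (Rng E e, [e], Src E e)"

datatype 'e signed = Pos 'e | Neg 'e

fun flip :: "'e signed \<Rightarrow> 'e signed" where
  "flip (Pos e) = Neg e"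
| "flip (Neg e) = Pos e"

definition augmented :: "('v, 'e) graph \<Rightarrow> ('v, 'e signed) graph" where
  "augmented E = \<lparr>
     Vert = Vert E,
     Edge = Pos ` Edge E \<union> Neg ` Edge E,
     Rng = case_signed (Rng E) (Src E),
     Src = case_signed (Src E) (Rng E) \<rparr>"

definition cancellation_relations ::
  "('v, 'e) graph \<Rightarrow> (('v, 'e signed) path \<times> ('v, 'e signed) path) set" where
  "cancellation_relations E =
     {((Src (augmented E) x, [flip x, x], Src (augmented E) x), empty_path (Src (augmented E) x)) | x.
        x \<in> Edge (augmented E)}"


section \<open>k-graphs\<close>

text \<open>
  \<open>\<nat>\<^sup>k\<close> is the set of functions on \<open>nat\<close> that vanish at all
  indices from \<open>k\<close> on, with pointwise addition; the basis is indexed by \<open>0, \<dots>, k - 1\<close>.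
\<close>

definition Nk :: "nat \<Rightarrow> (nat \<Rightarrow> nat) set" where
  "Nk k = {n. \<forall>j\<ge>k. n j = 0}"

definition unit_deg :: "nat \<Rightarrow> nat \<Rightarrow> nat" where
  "unit_deg i = (\<lambda>j. if j = i then 1 else 0)"

locale k_graph = category L for L :: "'a cat" +
  fixes k :: nat and d :: "'a \<Rightarrow> nat \<Rightarrow> nat"
  assumes countable_Arr: "countable (Arr L)"
    and deg_Nk: "a \<in> Arr L \<Longrightarrow> d a \<in> Nk k"
    and deg_Obj: "v \<in> Obj L \<Longrightarrow> d v = 0"
    and deg_Comp: "\<lbrakk>a \<in> Arr L; b \<in> Arr L; Dom L a = Cod L b\<rbrakk> \<Longrightarrow> d (Comp L a b) = d a + d b"
    and factorization: "\<lbrakk>a \<in> Arr L; n \<in> Nk k; l \<in> Nk k; d a = n + l\<rbrakk> \<Longrightarrow>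
      \<exists>!(b, c)\<in>Arr L \<times> Arr L. d b = n \<and> d c = l \<and> Dom L b = Cod L c \<and> a = Comp L b c"

definition skeleton :: "nat \<Rightarrow> 'a cat \<Rightarrow> ('a \<Rightarrow> nat \<Rightarrow> nat) \<Rightarrow> ('a, 'a) graph" where
  "skeleton k L d = \<lparr>
     Vert = Obj L,
     Edge = (\<Union>i<k. {a \<in> Arr L. d a = unit_deg i}),
     Rng = Cod L,
     Src = Dom L \<rparr>"

definition commuting_squares ::
  "nat \<Rightarrow> 'a cat \<Rightarrow> ('a \<Rightarrow> nat \<Rightarrow> nat) \<Rightarrow> (('a, 'a signed) path \<times> ('a, 'a signed) path) set" where
  "commuting_squares k L d =
     {((Cod L e, [Pos e, Pos f], Dom L f), (Cod L g, [Pos g, Pos h], Dom L h)) | e f g h.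
        {e, f, g, h} \<subseteq> Edge (skeleton k L d) \<and> Dom L e = Cod L f \<and> d e \<noteq> d f \<and>
        Dom L g = Cod L h \<and> Comp L e f = Comp L g h \<and> d g = d f \<and> d h = d e}"


section \<open>Existence of the fundamental groupoid\<close>

locale cat_relations = category C for C :: "'a cat" +
  fixes K :: "('a \<times> 'a) set"
  assumes parallel: "(a, b) \<in> K \<Longrightarrow> a \<in> Arr C \<and> b \<in> Arr C \<and> Dom C a = Dom C b \<and> Cod C a = Cod C b"
begin

lemma cc_parallel:
  "(a, b) \<in> congruence_closure C K \<Longrightarrow>
    a \<in> Arr C \<and> b \<in> Arr C \<and> Dom C a = Dom C b \<and> Cod C a = Cod C b"
  by (induction rule: congruence_closure.induct)
    (auto dest: parallel simp: Comp_closed Dom_Comp Cod_Comp)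

lemma cc_equiv: "equiv (Arr C) (congruence_closure C K)"
  by (rule equivI)
    (auto intro!: refl_onI symI transI dest: cc_parallel intro: congruence_closure.intros)

lemma cong_class_eq_iff:
  "\<lbrakk>a \<in> Arr C; b \<in> Arr C\<rbrakk> \<Longrightarrow> cong_class C K a = cong_class C K b \<longleftrightarrow> (a, b) \<in> congruence_closure C K"
  using eq_equiv_class_iff[OF cc_equiv] by (simp add: cong_class_def)

lemma cong_class_eqI: "(a, b) \<in> congruence_closure C K \<Longrightarrow> cong_class C K a = cong_class C K b"
  using cong_class_eq_iff cc_parallel by blast

lemma mem_cong_class: "b \<in> cong_class C K a \<longleftrightarrow> (a, b) \<in> congruence_closure C K"
  by (simp add: cong_class_def)

lemma Arr_quotient: "Arr (quotient_cat C K) = cong_class C K ` Arr C"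
  by (auto simp: quotient_cat_def quotient_def cong_class_def)

lemma Dom_quotient:
  assumes "a \<in> Arr C"
  shows "Dom (quotient_cat C K) (cong_class C K a) = cong_class C K (Dom C a)"
proof -
  have "a \<in> cong_class C K a" using assms by (simp add: mem_cong_class congruence_closure.refl)
  moreover have "cong_class C K (Dom C b) = cong_class C K (Dom C a)" if "b \<in> cong_class C K a" for b
    using cc_parallel[of a b] that by (simp add: mem_cong_class)
  ultimately have "(\<Union>b\<in>cong_class C K a. cong_class C K (Dom C b)) = cong_class C K (Dom C a)"
    by (intro SUP_eq_const; blast)
  then show ?thesis by (simp add: quotient_cat_def)
qed

lemma Cod_quotient:
  assumes "a \<in> Arr C"
  shows "Cod (quotient_cat C K) (cong_class C K a) = cong_class C K (Cod C a)"
proof -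
  have "a \<in> cong_class C K a" using assms by (simp add: mem_cong_class congruence_closure.refl)
  moreover have "cong_class C K (Cod C b) = cong_class C K (Cod C a)" if "b \<in> cong_class C K a" for b
    using cc_parallel[of a b] that by (simp add: mem_cong_class)
  ultimately have "(\<Union>b\<in>cong_class C K a. cong_class C K (Cod C b)) = cong_class C K (Cod C a)"
    by (intro SUP_eq_const; blast)
  then show ?thesis by (simp add: quotient_cat_def)
qed

lemma Comp_quotient:
  assumes "a \<in> Arr C" "b \<in> Arr C" "Dom C a = Cod C b"
  shows "Comp (quotient_cat C K) (cong_class C K a) (cong_class C K b) = cong_class C K (Comp C a b)"
proof -
  have ab: "a \<in> cong_class C K a" "b \<in> cong_class C K b"
    using assms by (simp_all add: mem_cong_class congruence_closure.refl)
  have comp: "cong_class C K (Comp C a' b') = cong_class C K (Comp C a b)" "Dom C a' = Cod C b'"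
    if "a' \<in> cong_class C K a" "b' \<in> cong_class C K b" for a' b'
  proof -
    have *: "(a, a') \<in> congruence_closure C K" "(b, b') \<in> congruence_closure C K"
      using that by (simp_all add: mem_cong_class)
    show "cong_class C K (Comp C a' b') = cong_class C K (Comp C a b)"
      using cong_class_eqI[OF congruence_closure.comp[OF * assms(3)]] by simp
    show "Dom C a' = Cod C b'"
      using cc_parallel[OF *(1)] cc_parallel[OF *(2)] assms(3) by simp
  qed
  have "(\<Union>b'\<in>{b'\<in>cong_class C K b. Dom C a' = Cod C b'}. cong_class C K (Comp C a' b')) =
      cong_class C K (Comp C a b)" if "a' \<in> cong_class C K a" for a'
  proof (rule SUP_eq_const)
    show "{b' \<in> cong_class C K b. Dom C a' = Cod C b'} \<noteq> {}"
      using comp(2)[OF that ab(2)] ab(2) by blast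
  qed (use comp(1)[OF that] in simp)
  note this[simp]
  have "(\<Union>a'\<in>cong_class C K a. \<Union>b'\<in>{b'\<in>cong_class C K b. Dom C a' = Cod C b'}.
      cong_class C K (Comp C a' b')) = cong_class C K (Comp C a b)"
    by (rule SUP_eq_const) (use ab in auto)
  then show ?thesis by (simp add: quotient_cat_def)
qed

lemma cong_class_Dom_Cod:
  assumes "a \<in> Arr C" "b \<in> Arr C"
  shows "cong_class C K (Dom C a) = cong_class C K (Cod C b) \<longleftrightarrow> Dom C a = Cod C b"
  using assms cc_parallel[of "Dom C a" "Cod C b"] cong_class_eq_iff[of "Dom C a" "Cod C b"]
  by (auto simp: Dom_closed Cod_closed Dom_Dom Dom_Cod)

lemma composable_quotient_iff:
  assumes "a \<in> Arr C" "b \<in> Arr C"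
  shows "Dom (quotient_cat C K) (cong_class C K a) = Cod (quotient_cat C K) (cong_class C K b)
    \<longleftrightarrow> Dom C a = Cod C b"
  using assms by (simp add: Dom_quotient Cod_quotient cong_class_Dom_Cod)

lemma category_quotient: "category (quotient_cat C K)"
  by unfold_locales
    (auto simp: Arr_quotient cong_class_Dom_Cod Dom_quotient Cod_quotient Comp_quotient
      Dom_closed Cod_closed Dom_Dom Cod_Dom Dom_Cod Cod_Cod Comp_closed Dom_Comp Cod_Comp
      Comp_Dom Comp_Cod Comp_assoc)

end

lemma path_cat_simps:
  "Arr (path_cat E) = {p. is_path E p}"
  "Dom (path_cat E) (v, es, w) = empty_path w"
  "Cod (path_cat E) (v, es, w) = empty_path v"
  "Comp (path_cat E) (v, es, w) (v', es', w') = (v, es @ es', w')"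
  by (simp_all add: path_cat_def)

locale graph =
  fixes E :: "('v, 'e) graph"
  assumes Rng_closed: "e \<in> Edge E \<Longrightarrow> Rng E e \<in> Vert E"
    and Src_closed: "e \<in> Edge E \<Longrightarrow> Src E e \<in> Vert E"
begin

lemma is_path_ends: "is_path E (v, es, w) \<Longrightarrow> v \<in> Vert E \<and> w \<in> Vert E"
  by (induction es arbitrary: v) (auto simp: Rng_closed)

lemma is_path_append: "\<lbrakk>is_path E (v, es, w); is_path E (w, fs, u)\<rbrakk> \<Longrightarrow> is_path E (v, es @ fs, u)"
  by (induction es arbitrary: v) auto

lemma category_path_cat: "category (path_cat E)"
  by unfold_locales
    (auto simp: path_cat_simps empty_path_def is_path_append dest: is_path_ends)

lemma graph_augmented: "graph (augmented E)"
  by unfold_locales (auto simp: augmented_def Rng_closed Src_closed)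

end

lemma flip_flip: "flip (flip x) = x"
  by (cases x) auto

lemma augmented_flip:
  "x \<in> Edge (augmented E) \<Longrightarrow> flip x \<in> Edge (augmented E)"
  "Rng (augmented E) (flip x) = Src (augmented E) x"
  "Src (augmented E) (flip x) = Rng (augmented E) x"
  by (cases x; auto simp: augmented_def)+

locale path_relations = graph E for E :: "('v, 'e) graph" +
  fixes K :: "(('v, 'e) path \<times> ('v, 'e) path) set"
  assumes path_parallel: "((v, es, w), (v', es', w')) \<in> K \<Longrightarrow>
    is_path E (v, es, w) \<and> is_path E (v', es', w') \<and> v = v' \<and> w = w'"

sublocale path_relations \<subseteq> cat_relations "path_cat E" K
proof -
  interpret category "path_cat E" by (rule category_path_cat)
  show "cat_relations (path_cat E) K"
  proof
    fix a b assume *: "(a, b) \<in> K"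
    obtain v es w where a: "a = (v, es, w)" by (cases a)
    obtain v' es' w' where b: "b = (v', es', w')" by (cases b)
    show "a \<in> Arr (path_cat E) \<and> b \<in> Arr (path_cat E) \<and>
        Dom (path_cat E) a = Dom (path_cat E) b \<and> Cod (path_cat E) a = Cod (path_cat E) b"
      using path_parallel[OF *[unfolded a b]] by (auto simp: a b path_cat_simps)
  qed
qed

fun path_eval :: "'b cat \<Rightarrow> ('v \<Rightarrow> 'b) \<Rightarrow> ('e \<Rightarrow> 'b) \<Rightarrow> ('v, 'e) path \<Rightarrow> 'b" where
  "path_eval D p q (v, [], w) = p w"
| "path_eval D p q (v, e # es, w) = Comp D (q e) (path_eval D p q (v, es, w))"

context path_relations
begin

abbreviation "Q \<equiv> quotient_cat (path_cat E) K"
abbreviation "cls \<equiv> cong_class (path_cat E) K"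

lemma cls_Cons:
  assumes "is_path E (v, e # es, w)"
  shows "cls (v, e # es, w) = Comp Q (canonical_edge E K e) (cls (Src E e, es, w))"
  using assms Comp_quotient[of "(Rng E e, [e], Src E e)" "(Src E e, es, w)"]
  by (auto simp: path_cat_simps canonical_edge_def empty_path_def Src_closed)

lemma canonical_vert_in: "v \<in> Vert E \<Longrightarrow> canonical_vert E K v \<in> Arr Q"
  by (auto simp: canonical_vert_def Arr_quotient path_cat_simps empty_path_def)

lemma canonical_edge_in: "e \<in> Edge E \<Longrightarrow> canonical_edge E K e \<in> Arr Q"
  by (auto simp: canonical_edge_def Arr_quotient path_cat_simps Src_closed)

lemma Dom_canonical_edge: "e \<in> Edge E \<Longrightarrow> Dom Q (canonical_edge E K e) = canonical_vert E K (Src E e)"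
  unfolding canonical_edge_def
  by (subst Dom_quotient) (auto simp: canonical_vert_def path_cat_simps Src_closed)

lemma Cod_canonical_edge: "e \<in> Edge E \<Longrightarrow> Cod Q (canonical_edge E K e) = canonical_vert E K (Rng E e)"
  unfolding canonical_edge_def
  by (subst Cod_quotient) (auto simp: canonical_vert_def path_cat_simps Src_closed)

lemma functor_eqI:
  assumes F: "is_functor Q D F" and F': "is_functor Q D F'"
    and v: "\<And>v. v \<in> Vert E \<Longrightarrow> F (canonical_vert E K v) = F' (canonical_vert E K v)"
    and e: "\<And>e. e \<in> Edge E \<Longrightarrow> F (canonical_edge E K e) = F' (canonical_edge E K e)"
  shows "F = F'"
proof (rule PiE_ext)
  show "F \<in> Arr Q \<rightarrow>\<^sub>E Arr D" "F' \<in> Arr Q \<rightarrow>\<^sub>E Arr D"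
    using F F' by (auto simp: is_functor_def)
next
  have *: "F (cls (v, es, w)) = F' (cls (v, es, w))" if "is_path E (v, es, w)" for v es w
    using that
  proof (induction es arbitrary: v)
    case Nil
    then show ?case using v by (auto simp: canonical_vert_def empty_path_def)
  next
    case (Cons x es)
    have p: "is_path E (Src E x, es, w)" and x: "x \<in> Edge E" using Cons.prems by auto
    have m: "cls (Src E x, es, w) \<in> Arr Q" using p by (auto simp: Arr_quotient path_cat_simps)
    have "Dom Q (canonical_edge E K x) = Cod Q (cls (Src E x, es, w))"
      using p x Src_closed
      by (auto simp: canonical_edge_def composable_quotient_iff path_cat_simps)
    then show ?case
      using F F' m canonical_edge_in[OF x] e[OF x] Cons.IH[OF p]
      by (simp add: cls_Cons[OF Cons.prems] is_functor_def)
  qed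
  show "F X = F' X" if "X \<in> Arr Q" for X
    using that * by (auto simp: Arr_quotient path_cat_simps)
qed

lemma functor_exists:
  assumes "category D"
    and pv: "\<And>v. v \<in> Vert E \<Longrightarrow> p v \<in> Obj D"
    and qe: "\<And>e. e \<in> Edge E \<Longrightarrow> q e \<in> Arr D \<and> Dom D (q e) = p (Src E e) \<and> Cod D (q e) = p (Rng E e)"
    and sat: "\<And>a b. (a, b) \<in> K \<Longrightarrow> path_eval D p q a = path_eval D p q b"
  shows "\<exists>F. is_functor Q D F \<and> (\<forall>v\<in>Vert E. F (canonical_vert E K v) = p v) \<and>
    (\<forall>e\<in>Edge E. F (canonical_edge E K e) = q e)"
proof -
  interpret D: category D by fact
  let ?e = "path_eval D p q"
  have pD: "p v \<in> Arr D" "Dom D (p v) = p v" "Cod D (p v) = p v" if "v \<in> Vert E" for v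
    using pv[OF that] D.Cod_Dom[of "p v"] by (auto simp: Obj_def)
  have ev: "?e (v, es, w) \<in> Arr D \<and> Dom D (?e (v, es, w)) = p w \<and> Cod D (?e (v, es, w)) = p v"
    if "is_path E (v, es, w)" for v es w
    using that
  proof (induction es arbitrary: v)
    case Nil
    then show ?case using pD by auto
  next
    case (Cons x es)
    have "?e (v, es, w) = ?e (Src E x, es, w)" by (induction es) auto
    with Cons qe[of x] show ?case by (auto simp: D.Comp_closed D.Dom_Comp D.Cod_Comp)
  qed
  have indep: "?e (v, es, w) = ?e (v', es, w)" for v v' es w by (induction es) auto
  have app: "?e (v, es @ fs, u) = Comp D (?e (v, es, w)) (?e (w, fs, u))"
    if "is_path E (v, es, w)" "is_path E (w, fs, u)" for v es w fs u
    using that(1)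
  proof (induction es arbitrary: v)
    case Nil
    then show ?case using ev[OF that(2)] D.Comp_Cod[of "?e (w, fs, u)"] by auto
  next
    case (Cons x es)
    have path: "is_path E (Src E x, es, w)" and x: "x \<in> Edge E" using Cons.prems by auto
    show ?case
      using Cons.IH[OF path] ev[OF path] ev[OF that(2)] qe[OF x]
        indep[of v "es @ fs" u "Src E x"] indep[of v es w "Src E x"]
      by (simp add: D.Comp_assoc)
  qed
  have resp: "?e a = ?e b" if "(a, b) \<in> congruence_closure (path_cat E) K" for a b
    using that
  proof (induction rule: congruence_closure.induct)
    case (comp a a' b b')
    obtain v es w where a: "a = (v, es, w)" by (cases a)
    obtain v' es' w' where a': "a' = (v', es', w')" by (cases a')
    obtain y fs z where b: "b = (y, fs, z)" by (cases b)
    obtain y' fs' z' where b': "b' = (y', fs', z')" by (cases b')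
    have 1: "is_path E a" "is_path E a'" "w = w'" "v = v'"
      using cc_parallel[OF comp.hyps(1)] by (auto simp: a a' path_cat_simps empty_path_def)
    have 2: "is_path E b" "is_path E b'" "y = y'" "z = z'"
      using cc_parallel[OF comp.hyps(2)] by (auto simp: b b' path_cat_simps empty_path_def)
    have 3: "w = y" using comp.hyps(3) by (simp add: a b path_cat_simps empty_path_def)
    have "?e (v, es @ fs, z) = ?e (v, es' @ fs', z)"
      using 1 2 3 comp.IH by (simp add: a a' b b' app)
    then show ?case using 1 2 3 by (simp add: a a' b b' path_cat_simps)
  qed (auto simp: sat)
  define F where "F = restrict (\<lambda>X. ?e (SOME a. a \<in> X)) (Arr Q)"
  have Fcls: "F (cls a) = ?e a" if a: "is_path E a" for a
  proof -
    have aA: "a \<in> Arr (path_cat E)" using a by (simp add: path_cat_simps)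
    then have "a \<in> cls a" by (simp add: mem_cong_class congruence_closure.refl)
    then have "(SOME b. b \<in> cls a) \<in> cls a" by (rule someI)
    then have "?e (SOME b. b \<in> cls a) = ?e a" using resp by (auto simp: mem_cong_class)
    then show ?thesis using aA by (simp add: F_def Arr_quotient)
  qed
  have "is_functor Q D F"
    unfolding is_functor_def
  proof (intro conjI ballI impI)
    have "F X \<in> Arr D" if "X \<in> Arr Q" for X
      using that Fcls ev by (auto simp: Arr_quotient path_cat_simps)
    then show "F \<in> Arr Q \<rightarrow>\<^sub>E Arr D" by (auto simp: F_def)
  next
    fix X assume "X \<in> Arr Q"
    then obtain v es w where X: "X = cls (v, es, w)" "is_path E (v, es, w)"
      by (auto simp: Arr_quotient path_cat_simps)
    have A: "(v, es, w) \<in> Arr (path_cat E)" using X by (simp add: path_cat_simps)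
    have "Dom Q X = cls (w, [], w)" "Cod Q X = cls (v, [], v)"
      using Dom_quotient[OF A] Cod_quotient[OF A] X by (auto simp: path_cat_simps empty_path_def)
    then show "F (Dom Q X) = Dom D (F X)" "F (Cod Q X) = Cod D (F X)"
      using X ev[OF X(2)] is_path_ends[OF X(2)] by (auto simp: Fcls)
  next
    fix X Y assume "X \<in> Arr Q" "Y \<in> Arr Q" and c: "Dom Q X = Cod Q Y"
    then obtain v es w y fs z where X: "X = cls (v, es, w)" "is_path E (v, es, w)"
      and Y: "Y = cls (y, fs, z)" "is_path E (y, fs, z)"
      by (auto simp: Arr_quotient path_cat_simps)
    have A: "(v, es, w) \<in> Arr (path_cat E)" "(y, fs, z) \<in> Arr (path_cat E)"
      using X Y by (auto simp: path_cat_simps)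
    have c': "Dom (path_cat E) (v, es, w) = Cod (path_cat E) (y, fs, z)"
      using c composable_quotient_iff[OF A] X Y by simp
    then have wy: "w = y" by (simp add: path_cat_simps empty_path_def)
    have "Comp Q X Y = cls (v, es @ fs, z)"
      using Comp_quotient[OF A c'] X Y by (simp add: path_cat_simps)
    then show "F (Comp Q X Y) = Comp D (F X) (F Y)"
      using X Y wy by (simp add: Fcls is_path_append app)
  qed
  moreover have "F (canonical_vert E K v) = p v" if "v \<in> Vert E" for v
    using that by (simp add: canonical_vert_def empty_path_def Fcls)
  moreover have "F (canonical_edge E K e) = q e" if "e \<in> Edge E" for e
    using that qe[OF that] D.Comp_Dom[of "q e"]
    by (simp add: canonical_edge_def Fcls Src_closed)
  ultimately show ?thesis by blast
qed

end

text \<open>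
  The Gabriel-Zisman construction: paths in the morphisms of \<open>L\<close> and their formal inverses, modulo
  cancellation and the composition of \<open>L\<close>.
\<close>

definition arrow_graph :: "'a cat \<Rightarrow> ('a, 'a) graph" where
  "arrow_graph L = \<lparr>Vert = Obj L, Edge = Arr L, Rng = Cod L, Src = Dom L\<rparr>"

definition composition_relations :: "'a cat \<Rightarrow> (('a, 'a signed) path \<times> ('a, 'a signed) path) set" where
  "composition_relations L =
     {((Cod L a, [Pos a, Pos b], Dom L b), (Cod L a, [Pos (Comp L a b)], Dom L b)) | a b.
        a \<in> Arr L \<and> b \<in> Arr L \<and> Dom L a = Cod L b} \<union>
     {((v, [Pos v], v), empty_path v) | v. v \<in> Obj L}"

definition fraction_relations :: "'a cat \<Rightarrow> (('a, 'a signed) path \<times> ('a, 'a signed) path) set" where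
  "fraction_relations L = cancellation_relations (arrow_graph L) \<union> composition_relations L"

definition fractions :: "'a cat \<Rightarrow> ('a, 'a signed) path set cat" where
  "fractions L = path_cat_mod (augmented (arrow_graph L)) (fraction_relations L)"

definition fractions_incl :: "'a cat \<Rightarrow> 'a \<Rightarrow> ('a, 'a signed) path set" where
  "fractions_incl L =
     restrict (\<lambda>a. canonical_edge (augmented (arrow_graph L)) (fraction_relations L) (Pos a)) (Arr L)"

lemma (in category) inverse_unique:
  assumes "a \<in> Arr C" "b \<in> Arr C" "c \<in> Arr C"
    "Dom C b = Cod C a" "Cod C b = Dom C a" "Dom C c = Cod C a" "Cod C c = Dom C a"
    "Comp C b a = Dom C a" "Comp C a c = Cod C a"
  shows "b = c"
proof -
  have "b = Comp C b (Comp C a c)" using assms Comp_Dom[of b] by simp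
  also have "\<dots> = Comp C (Comp C b a) c" using Comp_assoc[of b a c] assms by simp
  also have "\<dots> = c" using assms Comp_Cod[of c] by simp
  finally show ?thesis .
qed

lemma (in category) is_fundamental_groupoid_fractions:
  "is_fundamental_groupoid TYPE('x) C (fractions C) (fractions_incl C)"
proof -
  let ?E = "augmented (arrow_graph C)" and ?K = "fraction_relations C"
  interpret A: graph "arrow_graph C"
    by unfold_locales (auto simp: arrow_graph_def Obj_def Dom_closed Cod_closed Dom_Dom Dom_Cod)
  interpret E: graph ?E by (rule A.graph_augmented)
  have cod_obj: "Cod C v = v" if "v \<in> Obj C" for v
    using that Cod_Dom[of v] by (auto simp: Obj_def)
  have ObjA: "Dom C a \<in> Obj C" "Cod C a \<in> Obj C" if "a \<in> Arr C" for a
    using that by (auto simp: Obj_def Dom_closed Cod_closed Dom_Dom Dom_Cod)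
  note C_closed = Dom_closed Cod_closed Comp_closed and C_Comp = Dom_Comp Cod_Comp
  interpret path_relations ?E ?K
  proof
    fix v es w v' es' w' assume *: "((v, es, w), (v', es', w')) \<in> ?K"
    show "is_path ?E (v, es, w) \<and> is_path ?E (v', es', w') \<and> v = v' \<and> w = w'"
    proof (cases "((v, es, w), (v', es', w')) \<in> cancellation_relations (arrow_graph C)")
      case True
      then show ?thesis
        by (auto simp: cancellation_relations_def empty_path_def augmented_flip
            intro: E.Src_closed)
    next
      case False
      then have "((v, es, w), (v', es', w')) \<in> composition_relations C"
        using * by (simp add: fraction_relations_def)
      then show ?thesis
        by (auto simp: composition_relations_def empty_path_def augmented_def arrow_graph_def
            Comp_closed Dom_Comp Cod_Comp ObjA cod_obj, auto simp: Obj_def)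
    qed
  qed
  have Q: "fractions C = Q" by (simp add: fractions_def)
  have catQ: "category Q" by (rule category_quotient)
  let ?v = "canonical_vert ?E ?K" and ?e = "canonical_edge ?E ?K"
  have E_simps: "Vert ?E = Obj C" "Edge ?E = Pos ` Arr C \<union> Neg ` Arr C"
    "Rng ?E (Pos a) = Cod C a" "Src ?E (Pos a) = Dom C a"
    "Rng ?E (Neg a) = Dom C a" "Src ?E (Neg a) = Cod C a" for a
    by (auto simp: augmented_def arrow_graph_def)
  have comp2: "Comp Q (?e x) (?e y) = cls (Rng ?E x, [x, y], Src ?E y)"
    if "x \<in> Edge ?E" "y \<in> Edge ?E" "Src ?E x = Rng ?E y" for x y
    using that E.Src_closed cls_Cons[of "Rng ?E x" x "[y]" "Src ?E y"]
    by (simp add: canonical_edge_def)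
  have cancel: "Comp Q (?e (flip x)) (?e x) = ?v (Src ?E x)" if "x \<in> Edge ?E" for x
  proof -
    have "((Src ?E x, [flip x, x], Src ?E x), empty_path (Src ?E x)) \<in> ?K"
      using that by (auto simp: fraction_relations_def cancellation_relations_def)
    then have "cls (Src ?E x, [flip x, x], Src ?E x) = cls (empty_path (Src ?E x))"
      by (intro cong_class_eqI congruence_closure.base)
    then show ?thesis
      using comp2[of "flip x" x] that by (simp add: augmented_flip canonical_vert_def)
  qed
  have comp: "?e (Pos (Comp C a b)) = Comp Q (?e (Pos a)) (?e (Pos b))"
    if "a \<in> Arr C" "b \<in> Arr C" "Dom C a = Cod C b" for a b
  proof -
    have "((Cod C a, [Pos a, Pos b], Dom C b), (Cod C a, [Pos (Comp C a b)], Dom C b)) \<in> ?K"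
      using that by (auto simp: fraction_relations_def composition_relations_def)
    then have "cls (Cod C a, [Pos a, Pos b], Dom C b) = cls (Cod C a, [Pos (Comp C a b)], Dom C b)"
      by (intro cong_class_eqI congruence_closure.base)
    then show ?thesis using that comp2[of "Pos a" "Pos b"]
      by (simp add: E_simps canonical_edge_def C_Comp)
  qed
  have ident: "?e (Pos v) = ?v v" if "v \<in> Obj C" for v
  proof -
    have "((v, [Pos v], v), empty_path v) \<in> ?K"
      using that by (auto simp: fraction_relations_def composition_relations_def)
    then have "cls (v, [Pos v], v) = cls (empty_path v)"
      by (intro cong_class_eqI congruence_closure.base)
    then show ?thesis using that cod_obj[OF that]
      by (simp add: canonical_edge_def canonical_vert_def E_simps Obj_def)
  qed
  have i: "fractions_incl C a = ?e (Pos a)" if "a \<in> Arr C" for a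
    using that by (simp add: fractions_incl_def)
  have fun_i: "is_functor C Q (fractions_incl C)"
    unfolding is_functor_def
  proof (intro conjI ballI impI)
    show "fractions_incl C \<in> Arr C \<rightarrow>\<^sub>E Arr Q"
      by (auto simp: fractions_incl_def E_simps intro!: canonical_edge_in)
  qed (auto simp: i C_closed C_Comp comp ident ObjA Dom_canonical_edge
        Cod_canonical_edge E_simps)
  have inv_i: "invertible_in Q (?e (Pos a))" if "a \<in> Arr C" for a
    unfolding invertible_in_def
    using that cancel[of "Pos a"] cancel[of "Neg a"]
    by (auto simp: E_simps Dom_canonical_edge Cod_canonical_edge
        intro!: canonical_edge_in bexI[of _ "?e (Neg a)"])
  have univ: "\<exists>!F'. is_functor Q D F' \<and> (\<forall>a\<in>Arr C. F' (fractions_incl C a) = F a)"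
    if D: "category D" and F: "is_functor C D F" and inv: "\<forall>a\<in>Arr C. invertible_in D (F a)"
    for D :: "'x cat" and F
  proof (rule ex_ex1I)
    interpret D: category D by (rule D)
    have "\<forall>a\<in>Arr C. \<exists>b. b \<in> Arr D \<and> Dom D b = Cod D (F a) \<and> Cod D b = Dom D (F a) \<and>
        Comp D b (F a) = Dom D (F a) \<and> Comp D (F a) b = Cod D (F a)"
      using inv by (auto simp: invertible_in_def)
    then obtain J where J: "\<forall>a\<in>Arr C. J a \<in> Arr D \<and> Dom D (J a) = Cod D (F a) \<and>
        Cod D (J a) = Dom D (F a) \<and> Comp D (J a) (F a) = Dom D (F a) \<and> Comp D (F a) (J a) = Cod D (F a)"
      by metis
    have FA: "F a \<in> Arr D" "Dom D (F a) = F (Dom C a)" "Cod D (F a) = F (Cod C a)" if "a \<in> Arr C" for a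
      using F that by (auto simp: is_functor_def)
    have F_obj: "F v \<in> Obj D" if "v \<in> Obj C" for v
      using that FA[of v] by (auto simp: Obj_def)
    have F_comp: "F (Comp C a b) = Comp D (F a) (F b)"
      if "a \<in> Arr C" "b \<in> Arr C" "Dom C a = Cod C b" for a b
      using F that by (auto simp: is_functor_def)
    let ?q = "case_signed F J"
    have sat: "path_eval D F ?q a = path_eval D F ?q b" if "(a, b) \<in> ?K" for a b
    proof -
      have DF: "Comp D (F a) (F (Dom C a)) = F a" "Comp D (J a) (F (Cod C a)) = J a"
        if "a \<in> Arr C" for a
        using that D.Comp_Dom[of "F a"] D.Comp_Dom[of "J a"] FA[OF that] J by auto
      have "Comp D (F v) (F v) = F v" if "v \<in> Arr C" "Dom C v = v" for v
        using DF(1)[OF that(1)] that(2) by simp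
      then show ?thesis
        using that J FA DF F_comp DF[OF C_closed(3)] C_Comp
        unfolding fraction_relations_def cancellation_relations_def composition_relations_def
        by (auto simp: E_simps empty_path_def Obj_def)
    qed
    have "\<exists>F'. is_functor Q D F' \<and> (\<forall>v\<in>Vert ?E. F' (?v v) = F v) \<and> (\<forall>e\<in>Edge ?E. F' (?e e) = ?q e)"
      by (rule functor_exists[OF D _ _ sat]) (use J FA F_obj in \<open>auto simp: E_simps\<close>)
    then show "\<exists>F'. is_functor Q D F' \<and> (\<forall>a\<in>Arr C. F' (fractions_incl C a) = F a)"
      by (auto simp: i E_simps)
  next
    interpret D: category D by (rule D)
    fix F1 F2
    assume 1: "is_functor Q D F1 \<and> (\<forall>a\<in>Arr C. F1 (fractions_incl C a) = F a)"
      and 2: "is_functor Q D F2 \<and> (\<forall>a\<in>Arr C. F2 (fractions_incl C a) = F a)"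
    have pos: "F1 (?e (Pos a)) = F a" "F2 (?e (Pos a)) = F a" if "a \<in> Arr C" for a
      using 1 2 that i by auto
    have vert: "F1 (?v v) = F v" "F2 (?v v) = F v" if "v \<in> Obj C" for v
      using pos[of v] that ident[OF that] by (auto simp: Obj_def)
    have neg: "H (?e (Neg a)) \<in> Arr D \<and> Dom D (H (?e (Neg a))) = F (Cod C a) \<and>
        Cod D (H (?e (Neg a))) = F (Dom C a) \<and>
        Comp D (H (?e (Neg a))) (F a) = F (Dom C a) \<and> Comp D (F a) (H (?e (Neg a))) = F (Cod C a)"
      if a: "a \<in> Arr C" and H: "is_functor Q D H" "\<And>a. a \<in> Arr C \<Longrightarrow> H (?e (Pos a)) = F a" for a H
    proof -
      have Hv: "H (?v v) = F v" if "v \<in> Obj C" for v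
        using H(2)[of v] that ident[OF that] by (auto simp: Obj_def)
      have m: "?e (Neg a) \<in> Arr Q" "?e (Pos a) \<in> Arr Q"
        using a by (auto simp: E_simps intro!: canonical_edge_in)
      have dn: "Dom Q (?e (Neg a)) = ?v (Cod C a)" "Cod Q (?e (Neg a)) = ?v (Dom C a)"
        "Dom Q (?e (Pos a)) = ?v (Dom C a)" "Cod Q (?e (Pos a)) = ?v (Cod C a)"
        using a by (auto simp: E_simps Dom_canonical_edge Cod_canonical_edge)
      have c: "Comp Q (?e (Neg a)) (?e (Pos a)) = ?v (Dom C a)"
        "Comp Q (?e (Pos a)) (?e (Neg a)) = ?v (Cod C a)"
        using a cancel[of "Pos a"] cancel[of "Neg a"] by (auto simp: E_simps)
      have Hd: "\<And>X. X \<in> Arr Q \<Longrightarrow> H (Dom Q X) = Dom D (H X) \<and> H (Cod Q X) = Cod D (H X) \<and> H X \<in> Arr D"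
        and Hc: "\<And>X Y. \<lbrakk>X \<in> Arr Q; Y \<in> Arr Q; Dom Q X = Cod Q Y\<rbrakk> \<Longrightarrow> H (Comp Q X Y) = Comp D (H X) (H Y)"
        using H(1) by (auto simp: is_functor_def)
      show ?thesis
        using Hd[OF m(1)] Hc[OF m] Hc[OF m(2) m(1)] H(2)[OF a] Hv ObjA[OF a] by (simp add: dn c)
    qed
    have "F1 (?e (Neg a)) = F2 (?e (Neg a))" if a: "a \<in> Arr C" for a
      by (rule D.inverse_unique[of "F a"])
        (use neg[OF a, of F1] neg[OF a, of F2] 1 2 pos F a in \<open>auto simp: is_functor_def\<close>)
    then show "F1 = F2"
      using 1 2 pos vert by (intro functor_eqI[of D]) (auto simp: E_simps)
  qed
  show ?thesis
    unfolding is_fundamental_groupoid_def Q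
    using catQ fun_i inv_i univ by (auto simp: i)
qed

end

theory Submission
  imports Defs
begin

text \<open>
  A \<open>k\<close>-graph is presented by its edges and commuting squares: every morphism is a composite of
  edges, and two such composites are equal only if commuting squares transform one into the other,
  because the factorization property allows any edge to be moved to the front. Adjoining formal
  inverses of the edges alone already inverts every composite of edges, so
  \<open>\<P>(E\<^sup>+)/(C \<union> S)\<close> has the universal property of the category of fractions, and two
  categories with this property are related by a unique isomorphism under \<open>\<Lambda>\<close>.
\<close>

section \<open>Functors and invertible morphisms\<close>

lemma is_functorD:
  assumes "is_functor C D F"
  shows "a \<in> Arr C \<Longrightarrow> F a \<in> Arr D"
    and "a \<in> Arr C \<Longrightarrow> F (Dom C a) = Dom D (F a)"
    and "a \<in> Arr C \<Longrightarrow> F (Cod C a) = Cod D (F a)"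
    and "\<lbrakk>a \<in> Arr C; b \<in> Arr C; Dom C a = Cod C b\<rbrakk> \<Longrightarrow> F (Comp C a b) = Comp D (F a) (F b)"
  using assms by (auto simp: is_functor_def)

lemma is_functor_ext:
  assumes "is_functor C D F" "is_functor C D F'" "\<And>a. a \<in> Arr C \<Longrightarrow> F a = F' a"
  shows "F = F'"
  using assms unfolding is_functor_def by (blast intro: PiE_ext)

text \<open>Functors are \<open>undefined\<close> off their source, so a function given by a formula
  has to be cut down before it can be one.\<close>

lemma (in category) is_functor_restrict:
  assumes "\<And>a. a \<in> Arr C \<Longrightarrow> F a \<in> Arr D"
    and "\<And>a. a \<in> Arr C \<Longrightarrow> F (Dom C a) = Dom D (F a)"
    and "\<And>a. a \<in> Arr C \<Longrightarrow> F (Cod C a) = Cod D (F a)"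
    and "\<And>a b. \<lbrakk>a \<in> Arr C; b \<in> Arr C; Dom C a = Cod C b\<rbrakk> \<Longrightarrow> F (Comp C a b) = Comp D (F a) (F b)"
  shows "is_functor C D (restrict F (Arr C))"
  using assms by (auto simp: is_functor_def Dom_closed Cod_closed Comp_closed)

lemma (in category) is_functor_compose:
  assumes "is_functor C D F" "is_functor D B H"
  shows "is_functor C B (compose (Arr C) H F)"
  unfolding compose_def
proof (rule is_functor_restrict)
  note F = is_functorD[OF assms(1)] and H = is_functorD[OF assms(2)]
  show "H (F (Comp C a b)) = Comp B (H (F a)) (H (F b))"
    if "a \<in> Arr C" "b \<in> Arr C" "Dom C a = Cod C b" for a b
    using that F(2)[of a] F(3)[of b] by (simp add: F(1,4) H(4))
qed (simp_all add: is_functorD[OF assms(1)] is_functorD[OF assms(2)])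

lemma (in category) is_functor_id: "is_functor C C (restrict id (Arr C))"
  by (rule is_functor_restrict) auto

lemma (in category) Obj_simps:
  assumes "v \<in> Obj C"
  shows "v \<in> Arr C" "Dom C v = v" "Cod C v = v"
  using assms Cod_Dom[of v] by (auto simp: Obj_def)

lemma (in category) Dom_Cod_in_Obj:
  assumes "a \<in> Arr C"
  shows "Dom C a \<in> Obj C" "Cod C a \<in> Obj C"
  using assms by (auto simp: Obj_def Dom_closed Cod_closed Dom_Dom Dom_Cod)

text \<open>\<open>invertible_in\<close> with its witness named, so that inverses can be compared
  and carried along functors.\<close>

definition inverse_in :: "'a cat \<Rightarrow> 'a \<Rightarrow> 'a \<Rightarrow> bool" where
  "inverse_in C a b \<longleftrightarrow> a \<in> Arr C \<and> b \<in> Arr C \<and> Dom C b = Cod C a \<and> Cod C b = Dom C a \<and>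
     Comp C b a = Dom C a \<and> Comp C a b = Cod C a"

lemma invertible_in_iff: "invertible_in C a \<longleftrightarrow> (\<exists>b. inverse_in C a b)"
  by (auto simp: invertible_in_def inverse_in_def)

lemma (in category) inverse_in_unique: "\<lbrakk>inverse_in C a b; inverse_in C a c\<rbrakk> \<Longrightarrow> b = c"
  by (rule inverse_unique[of a]) (auto simp: inverse_in_def)

lemma inverse_in_functor:
  assumes "is_functor C D F" "inverse_in C a b"
  shows "inverse_in D (F a) (F b)"
  using assms(2) is_functorD[OF assms(1), of a] is_functorD[OF assms(1), of b]
  unfolding inverse_in_def by metis

lemma (in category) invertible_Obj: "v \<in> Obj C \<Longrightarrow> invertible_in C v"
  using Obj_simps[of v] Comp_Dom[of v] by (auto simp: invertible_in_def)

text \<open>With inverses \<open>a'\<close> and \<open>b'\<close>, the composite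
  \<open>b' a'\<close> works on both sides: the inner pair cancels to an identity, then the outer
  pair.\<close>

lemma (in category) invertible_Comp:
  assumes "invertible_in C a" "invertible_in C b" "Dom C a = Cod C b"
  shows "invertible_in C (Comp C a b)"
proof -
  obtain a' b' where a: "inverse_in C a a'" and b: "inverse_in C b b'"
    using assms by (auto simp: invertible_in_iff)
  have "Comp C (Comp C b' a') (Comp C a b) = Comp C b' (Comp C (Comp C a' a) b)"
    using a b assms(3) Comp_assoc[of a' a b]
    by (simp add: inverse_in_def Comp_assoc Comp_closed Dom_Comp Cod_Comp)
  also have "\<dots> = Dom C b"
    using a b assms(3) by (simp add: inverse_in_def Comp_Cod)
  finally have l: "Comp C (Comp C b' a') (Comp C a b) = Dom C b" .
  have "Comp C (Comp C a b) (Comp C b' a') = Comp C a (Comp C (Comp C b b') a')"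
    using a b assms(3) Comp_assoc[of b b' a']
    by (simp add: inverse_in_def Comp_assoc Comp_closed Dom_Comp Cod_Comp)
  also have "\<dots> = Cod C a"
  proof -
    have "Comp C (Cod C b) a' = a'" using a assms(3) Comp_Cod[of a'] by (simp add: inverse_in_def)
    then show ?thesis using a b by (simp add: inverse_in_def)
  qed
  finally have r: "Comp C (Comp C a b) (Comp C b' a') = Cod C a" .
  have "inverse_in C (Comp C a b) (Comp C b' a')"
    using a b assms(3) l r by (simp add: inverse_in_def Comp_closed Dom_Comp Cod_Comp)
  then show ?thesis by (auto simp: invertible_in_iff)
qed

section \<open>Uniqueness of the category of fractions up to isomorphism\<close>

lemma is_fundamental_groupoidD:
  assumes "is_fundamental_groupoid TYPE('x) L G i"
  shows "category G" "is_functor L G i" "\<And>a. a \<in> Arr L \<Longrightarrow> invertible_in G (i a)"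
    and "\<And>(D :: 'x cat) F. \<lbrakk>category D; is_functor L D F; \<And>a. a \<in> Arr L \<Longrightarrow> invertible_in D (F a)\<rbrakk>
      \<Longrightarrow> \<exists>!F'. is_functor G D F' \<and> (\<forall>a\<in>Arr L. F' (i a) = F a)"
  using assms unfolding is_fundamental_groupoid_def by blast+

text \<open>Both \<open>F\<close> and the identity of \<open>G\<close> factor \<open>i\<close>
  through itself, so the universal property at the morphism type of \<open>G\<close> itself
  identifies them.\<close>

lemma fundamental_groupoid_endo:
  fixes G :: "'g cat"
  assumes G: "is_fundamental_groupoid TYPE('g) L G i"
    and F: "is_functor G G F" "\<And>a. a \<in> Arr L \<Longrightarrow> F (i a) = i a" and b: "b \<in> Arr G"
  shows "F b = b"
proof -
  note D = is_fundamental_groupoidD[OF G]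
  interpret category G by (rule D)
  have "\<forall>a\<in>Arr L. restrict id (Arr G) (i a) = i a"
    using is_functorD(1)[OF D(2)] by simp
  then have "F = restrict id (Arr G)"
    using D(4)[OF D(1-3)] F is_functor_id by blast
  then show ?thesis using b by simp
qed

text \<open>Each inclusion factors through the other, and both round trips are endofunctors fixing
  an inclusion. The mixed types yield the two factorizations; each category at its own morphism type
  handles its round trip.\<close>

lemma fundamental_groupoid_unique:
  fixes G :: "'g cat" and G' :: "'h cat"
  assumes "is_fundamental_groupoid TYPE('g) L G i" "is_fundamental_groupoid TYPE('h) L G i"
    and "is_fundamental_groupoid TYPE('g) L G' i'" "is_fundamental_groupoid TYPE('h) L G' i'"
  shows "\<exists>T. is_isomorphism G G' T \<and> (\<forall>a\<in>Arr L. T (i a) = i' a)"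
proof -
  note D = is_fundamental_groupoidD[OF assms(1)] and D' = is_fundamental_groupoidD[OF assms(4)]
  interpret G: category G by (rule D)
  interpret G': category G' by (rule D')
  have mem: "i a \<in> Arr G" "i' a \<in> Arr G'" if "a \<in> Arr L" for a
    using that is_functorD(1)[OF D(2)] is_functorD(1)[OF D'(2)] by auto
  obtain T where T: "is_functor G G' T" "\<And>a. a \<in> Arr L \<Longrightarrow> T (i a) = i' a"
    using is_fundamental_groupoidD(4)[OF assms(2) D'(1-3)] by blast
  obtain H where H: "is_functor G' G H" "\<And>a. a \<in> Arr L \<Longrightarrow> H (i' a) = i a"
    using is_fundamental_groupoidD(4)[OF assms(3) D(1-3)] by blast
  have "H (T b) = b" if "b \<in> Arr G" for b
    using fundamental_groupoid_endo[OF assms(1) G.is_functor_compose[OF T(1) H(1)] _ that]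
    by (simp add: compose_def T H mem that)
  moreover have "T (H b) = b" if "b \<in> Arr G'" for b
    using fundamental_groupoid_endo[OF assms(4) G'.is_functor_compose[OF H(1) T(1)] _ that]
    by (simp add: compose_def T H mem that)
  ultimately show ?thesis using T H by (auto simp: is_isomorphism_def)
qed

section \<open>Presentation of a k-graph by edges and commuting squares\<close>

text \<open>A relation and not a function, because a morphism has many factorizations into edges;
  that the value does not depend on the choice is the content of
  \<open>ev_functional\<close>.\<close>

inductive edge_eval ::
  "('a, 'a) graph \<Rightarrow> 'a cat \<Rightarrow> 'b cat \<Rightarrow> ('a \<Rightarrow> 'b) \<Rightarrow> ('a \<Rightarrow> 'b) \<Rightarrow> 'a \<Rightarrow> 'b \<Rightarrow> bool"
  for E L D p q where
  vert: "v \<in> Vert E \<Longrightarrow> edge_eval E L D p q v (p v)"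
| edge: "\<lbrakk>e \<in> Edge E; edge_eval E L D p q a x; Dom L e = Cod L a\<rbrakk>
    \<Longrightarrow> edge_eval E L D p q (Comp L e a) (Comp D (q e) x)"

section \<open>Factorization, degree and induction along edges\<close>

context k_graph
begin

abbreviation "Sk \<equiv> skeleton k L d"

lemma skeleton_simps [simp]:
  "Vert Sk = Obj L" "e \<in> Edge Sk \<longleftrightarrow> e \<in> Arr L \<and> (\<exists>i<k. d e = unit_deg i)"
  "Rng Sk = Cod L" "Src Sk = Dom L"
  by (auto simp: skeleton_def)

lemma graph_skeleton: "graph Sk"
  by unfold_locales (auto simp: Dom_Cod_in_Obj)

lemma unit_deg_Nk: "i < k \<Longrightarrow> unit_deg i \<in> Nk k"
  by (auto simp: unit_deg_def Nk_def)

text \<open>Cancellation in the degree monoid makes the second factors agree in degree as well, so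
  the factorization property applies.\<close>

lemma factor_unique:
  assumes "b \<in> Arr L" "c \<in> Arr L" "Dom L b = Cod L c"
    and "b' \<in> Arr L" "c' \<in> Arr L" "Dom L b' = Cod L c'"
    and eq: "Comp L b c = Comp L b' c'" and deg: "d b = d b'"
  shows "b = b' \<and> c = c'"
proof -
  have "d b + d c = d b' + d c'"
    using deg_Comp[of b c] deg_Comp[of b' c'] assms by simp
  then have "d c = d c'" using deg by simp
  let ?P = "\<lambda>(x, y). d x = d b \<and> d y = d c \<and> Dom L x = Cod L y \<and> Comp L b c = Comp L x y"
  have "\<exists>!z. z \<in> Arr L \<times> Arr L \<and> ?P z"
    using factorization[OF Comp_closed deg_Nk deg_Nk deg_Comp] assms(1-3) by blast
  then obtain u where u: "\<And>z. z \<in> Arr L \<times> Arr L \<Longrightarrow> ?P z \<Longrightarrow> z = u" by (elim ex1E) blast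
  have "(b, c) = u" "(b', c') = u"
    by (rule u; use assms \<open>d c = d c'\<close> in simp)+
  then show ?thesis by auto
qed

lemma factor_exists:
  assumes "a \<in> Arr L" "n \<in> Nk k" "l \<in> Nk k" "d a = n + l"
  obtains b c where "b \<in> Arr L" "c \<in> Arr L" "d b = n" "d c = l" "Dom L b = Cod L c" "a = Comp L b c"
  using ex1_implies_ex[OF factorization[OF assms]] by (elim exE case_prodE) (use that in force)

text \<open>Every colour \<open>i\<close> occurring in the degree of \<open>a\<close> can be brought
  to the front. This freedom drives both the induction on morphisms and the exchange of leading
  edges.\<close>

lemma split_edge:
  assumes a: "a \<in> Arr L" and i: "d a i > 0"
  obtains e b where "e \<in> Edge Sk" "d e = unit_deg i" "b \<in> Arr L" "Dom L e = Cod L b" "a = Comp L e b"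
proof -
  \<comment> \<open>The truncated subtraction is exact because \<open>d a i > 0\<close>, so
    \<open>unit_deg i + l\<close> is the degree of \<open>a\<close>.\<close>
  define l where "l = (\<lambda>j. if j = i then d a j - 1 else d a j)"
  have ik: "i < k" using deg_Nk[OF a] i by (force simp: Nk_def not_less[symmetric])
  have l: "l \<in> Nk k" using deg_Nk[OF a] by (auto simp: Nk_def l_def)
  have "d a = unit_deg i + l" using i by (auto simp: fun_eq_iff l_def unit_deg_def)
  then obtain e b where "e \<in> Arr L" "b \<in> Arr L" "d e = unit_deg i" "Dom L e = Cod L b"
    "a = Comp L e b"
    by (rule factor_exists[OF a unit_deg_Nk[OF ik] l])
  then show ?thesis using ik by (intro that[of e b]) auto
qed

text \<open>The number of edges in any factorization of \<open>a\<close> into edges; it serves as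
  the induction measure.\<close>

definition total_deg :: "'a \<Rightarrow> nat" where
  "total_deg a = (\<Sum>i<k. d a i)"

lemma total_deg_edge:
  assumes "e \<in> Edge Sk" "a \<in> Arr L" "Dom L e = Cod L a"
  shows "total_deg (Comp L e a) = Suc (total_deg a)"
  using assms by (auto simp: total_deg_def deg_Comp sum.distrib unit_deg_def)

text \<open>Composing \<open>a\<close> with its source on the right and with its range on the left
  gives two factorizations of \<open>a\<close> whose first factors, \<open>a\<close> and
  \<open>Cod L a\<close>, both have degree 0; hence they coincide.\<close>

lemma Obj_if_deg_0:
  assumes a: "a \<in> Arr L" and "d a = 0"
  shows "a \<in> Obj L"
proof -
  have "a = Cod L a"
    using factor_unique[of a "Dom L a" "Cod L a" a] a assms(2) deg_Obj[OF Dom_Cod_in_Obj(2)[OF a]]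
    by (simp add: Dom_closed Cod_closed Cod_Dom Dom_Cod Comp_Dom Comp_Cod)
  then show ?thesis using Dom_Cod_in_Obj(2)[OF a] by simp
qed

text \<open>Splitting off a leading edge lowers \<open>total_deg\<close>, and a morphism of degree 0
  is an object.\<close>

lemma arr_induct [consumes 1, case_names vert edge]:
  assumes "a \<in> Arr L"
    and vert: "\<And>v. v \<in> Obj L \<Longrightarrow> P v"
    and edge: "\<And>e b. \<lbrakk>e \<in> Edge Sk; b \<in> Arr L; Dom L e = Cod L b; P b\<rbrakk> \<Longrightarrow> P (Comp L e b)"
  shows "P a"
  using assms(1)
proof (induction "total_deg a" arbitrary: a rule: less_induct)
  case less
  show ?case
  proof (cases "d a = 0")
    case True
    then show ?thesis using vert Obj_if_deg_0 less.prems by blast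
  next
    case False
    then obtain i where "d a i > 0" by (auto simp: fun_eq_iff)
    then obtain e b where e: "e \<in> Edge Sk" "b \<in> Arr L" "Dom L e = Cod L b" "a = Comp L e b"
      by (rule split_edge[OF less.prems])
    then show ?thesis using edge less.hyps[of b] total_deg_edge[of e b] by simp
  qed
qed

lemma functor_skeleton_eqI:
  assumes F: "is_functor L D F" and F': "is_functor L D F'"
    and "\<And>v. v \<in> Obj L \<Longrightarrow> F v = F' v" "\<And>e. e \<in> Edge Sk \<Longrightarrow> F e = F' e"
  shows "F = F'"
proof (rule is_functor_ext[OF F F'])
  show "F a = F' a" if "a \<in> Arr L" for a
    using that
  proof (induction rule: arr_induct)
    case (edge e b)
    then have "e \<in> Arr L" by simp
    then show ?case
      using edge assms(4)[OF edge(1)] by (simp add: is_functorD(4)[OF F] is_functorD(4)[OF F'])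
  qed (use assms in auto)
qed

end

section \<open>Diagrams on the skeleton that satisfy the commuting squares extend to
  functors\<close>

locale square_diagram = k_graph L k d + D: category D
  for L :: "'a cat" and k d and D :: "'b cat" +
  fixes p q :: "'a \<Rightarrow> 'b"
  assumes vert_Obj: "v \<in> Obj L \<Longrightarrow> p v \<in> Obj D"
    and edge_Arr: "e \<in> Edge Sk \<Longrightarrow> q e \<in> Arr D"
    and Dom_edge: "e \<in> Edge Sk \<Longrightarrow> Dom D (q e) = p (Dom L e)"
    and Cod_edge: "e \<in> Edge Sk \<Longrightarrow> Cod D (q e) = p (Cod L e)"
    and square: "\<lbrakk>{e, f, g, h} \<subseteq> Edge Sk; Dom L e = Cod L f; d e \<noteq> d f; Dom L g = Cod L h;
      Comp L e f = Comp L g h; d g = d f; d h = d e\<rbrakk> \<Longrightarrow> Comp D (q e) (q f) = Comp D (q g) (q h)"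
begin

abbreviation "ev \<equiv> edge_eval Sk L D p q"

lemma ev_closed:
  "ev a x \<Longrightarrow> a \<in> Arr L \<and> x \<in> Arr D \<and> Dom D x = p (Dom L a) \<and> Cod D x = p (Cod L a)"
proof (induction rule: edge_eval.induct)
  case (vert v)
  then show ?case using D.Obj_simps[OF vert_Obj] Obj_simps[of v] by simp
next
  case (edge e a x)
  then have "e \<in> Arr L" by simp
  with edge show ?case
    using edge_Arr[OF edge(1)] Dom_edge[OF edge(1)] Cod_edge[OF edge(1)]
    by (simp add: Comp_closed Dom_Comp Cod_Comp D.Comp_closed D.Dom_Comp D.Cod_Comp)
qed

lemma ev_total: "a \<in> Arr L \<Longrightarrow> \<exists>x. ev a x"
  by (induction rule: arr_induct) (force intro: edge_eval.intros)+

text \<open>The edges of \<open>a\<close> are put in front of a factorization of \<open>b\<close>;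
  the vertex value that ended the factorization of \<open>a\<close> acts as an identity on
  \<open>y\<close>.\<close>

lemma ev_Comp: "\<lbrakk>ev a x; ev b y; Dom L a = Cod L b\<rbrakk> \<Longrightarrow> ev (Comp L a b) (Comp D x y)"
proof (induction rule: edge_eval.induct)
  case (vert v)
  then have "v = Cod L b" using Obj_simps[of v] by simp
  then show ?case using vert ev_closed[OF vert(2)] Comp_Cod[of b] D.Comp_Cod[of y] by simp
next
  case (edge e a x)
  have e: "e \<in> Arr L" using edge(1) by simp
  note * = ev_closed[OF edge(2)] ev_closed[OF edge.prems(1)]
  have "Dom L a = Cod L b" using edge.prems(2) * e edge(3) by (simp add: Dom_Comp)
  then show ?case
    using edge_eval.edge[OF edge(1) edge.IH] * e edge edge_Arr[OF edge(1)] Dom_edge[OF edge(1)]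
    by (simp add: Comp_assoc D.Comp_assoc Cod_Comp)
qed

text \<open>Strong induction on the number of edges. If two factorizations of \<open>a\<close> begin
  with edges of the same degree, unique factorization identifies these edges and the remainders;
  otherwise a commuting square exchanges the leading edges.\<close>

lemma ev_functional: "\<lbrakk>ev a x; ev a y\<rbrakk> \<Longrightarrow> x = y"
proof (induction "total_deg a" arbitrary: a x y rule: less_induct)
  case less
  have obj: "total_deg v = 0" if "v \<in> Obj L" for v
    using deg_Obj[OF that] by (simp add: total_deg_def)
  show ?case
  proof (cases "total_deg a = 0")
    case True
    have "z = p a" if "ev a z" for z
      using that
    proof cases
      case (edge e b w)
      then show ?thesis using True total_deg_edge[of e b] ev_closed by simp
    qed simp
    then show ?thesis using less.prems by blast
  next
    case False
    obtain e b x' where e: "e \<in> Edge Sk" "a = Comp L e b" "x = Comp D (q e) x'" "ev b x'"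
      "Dom L e = Cod L b"
      using less.prems(1) False obj by (cases rule: edge_eval.cases) auto
    obtain f c y' where f: "f \<in> Edge Sk" "a = Comp L f c" "y = Comp D (q f) y'" "ev c y'"
      "Dom L f = Cod L c"
      using less.prems(2) False obj by (cases rule: edge_eval.cases) auto
    have A: "b \<in> Arr L" "c \<in> Arr L" "e \<in> Arr L" "f \<in> Arr L"
      using ev_closed e(1,4) f(1,4) by auto
    \<comment> \<open>Both remainders \<open>b\<close> and \<open>c\<close> have one edge fewer than
      \<open>a\<close>, so values are already known to be unique on either.\<close>
    have IH: "z = w" if "ev u z" "ev u w" "u = b \<or> u = c" for u z w
      using less.hyps[OF _ that(1,2)] that(3) total_deg_edge[OF e(1) A(1) e(5)]
        total_deg_edge[OF f(1) A(2) f(5)] e(2) f(2) by auto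
    show ?thesis
    proof (cases "d e = d f")
      case True
      then have "e = f \<and> b = c" using factor_unique[of e b f c] e f A by simp
      then show ?thesis using IH[of b x' y'] e f by simp
    next
      case False
      \<comment> \<open>Write \<open>b = g m\<close> with \<open>d g = d f\<close>; the square \<open>e g = f h\<close> then gives \<open>c = h m\<close>.\<close>
      obtain i j where i: "d e = unit_deg i" and j: "d f = unit_deg j" using e(1) f(1) by auto
      have "d e + d b = d f + d c"
        using deg_Comp[of e b] deg_Comp[of f c] e f A by simp
      \<comment> \<open>At coordinate \<open>j\<close> the edge \<open>e\<close> contributes 0 and
        \<open>f\<close> contributes 1, so the missing unit must come from \<open>b\<close>.\<close>
      then have "(d e + d b) j = (d f + d c) j" by simp
      then have "d b j > 0" using False i j by (auto simp: unit_deg_def split: if_splits)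
      then obtain g m where g: "g \<in> Edge Sk" "d g = unit_deg j" "m \<in> Arr L" "Dom L g = Cod L m"
        "b = Comp L g m"
        by (rule split_edge[OF A(1)])
      have gA: "g \<in> Arr L" using g by simp
      have eg: "Dom L e = Cod L g" using e(5) g gA by (simp add: Cod_Comp)
      have egA: "Comp L e g \<in> Arr L" using A(3) gA eg by (rule Comp_closed)
      have "d (Comp L e g) = d f + d e"
        using deg_Comp[OF A(3) gA eg] g(2) j by (simp add: add.commute)
      then obtain f' h where h: "f' \<in> Arr L" "h \<in> Arr L" "d f' = d f" "d h = d e"
        "Dom L f' = Cod L h" "Comp L e g = Comp L f' h"
        by (rule factor_exists[OF egA deg_Nk[OF A(4)] deg_Nk[OF A(3)]])
      have hm: "Dom L h = Cod L m"
        using Dom_Comp[OF A(3) gA eg] Dom_Comp[OF h(1,2,5)] h(6) g(4) by simp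
      have "Comp L f c = Comp L (Comp L e g) m"
        using e(2) f(2) g A gA eg by (simp add: Comp_assoc)
      also have "\<dots> = Comp L f' (Comp L h m)"
        using h g(3) hm by (simp add: Comp_assoc)
      finally have "f = f' \<and> c = Comp L h m"
        using factor_unique[of f c f' "Comp L h m"] A f(5) h g(3) hm
        by (simp add: Comp_closed Cod_Comp)
      then have f': "f' = f" and c: "c = Comp L h m" by auto
      have hE: "h \<in> Edge Sk" using h(2,4) e(1) by simp
      \<comment> \<open>Any value of the common tail \<open>m\<close> will do: uniqueness on
        \<open>b\<close> and \<open>c\<close> expresses \<open>x'\<close> and \<open>y'\<close>
        through it, and \<open>square\<close> matches what stands in front.\<close>
      obtain z where z: "ev m z" using ev_total[OF g(3)] by blast
      have x': "x' = Comp D (q g) z"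
        using IH[OF e(4)] edge_eval.edge[OF g(1) z g(4)] g(5) by simp
      have y': "y' = Comp D (q h) z"
        using IH[OF f(4)] edge_eval.edge[OF hE z hm] c by simp
      note zD = ev_closed[OF z]
      have sq: "Comp D (q e) (q g) = Comp D (q f) (q h)"
        by (rule square) (use e(1) f(1) g(1,2) hE eg h False j f' in auto)
      have "x = Comp D (Comp D (q e) (q g)) z"
        using e(1,3) x' zD edge_Arr[OF e(1)] edge_Arr[OF g(1)] Dom_edge[OF e(1)] Dom_edge[OF g(1)]
          Cod_edge[OF g(1)] eg g(4) by (simp add: D.Comp_assoc)
      also have "\<dots> = y"
        unfolding sq
        using f(3) y' zD edge_Arr[OF f(1)] edge_Arr[OF hE] Dom_edge[OF f(1)] Dom_edge[OF hE]
          Cod_edge[OF hE] h(5) f' hm by (simp add: D.Comp_assoc)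
      finally show ?thesis .
    qed
  qed
qed

lemma functor_extends:
  "\<exists>F. is_functor L D F \<and> (\<forall>v\<in>Obj L. F v = p v) \<and> (\<forall>e\<in>Edge Sk. F e = q e)"
proof -
  define F where "F a = (THE x. ev a x)" for a
  have F: "F a = x" if "ev a x" for a x
    unfolding F_def using that ev_functional by blast
  have evF: "ev a (F a)" if "a \<in> Arr L" for a
    using ev_total[OF that] F by auto
  have v: "F v = p v" if "v \<in> Obj L" for v
    using that by (intro F edge_eval.vert) simp
  have "F e = q e" if e: "e \<in> Edge Sk" for e
  proof -
    have eA: "e \<in> Arr L" using e by simp
    \<comment> \<open>An edge is evaluated through its factorization with the empty remainder at its
      source, where \<open>p\<close> supplies an identity of \<open>D\<close>.\<close>
    have "ev (Comp L e (Dom L e)) (Comp D (q e) (p (Dom L e)))"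
      using e eA by (intro edge_eval.intros) (auto simp: Dom_Cod_in_Obj Cod_Dom)
    then show ?thesis
      using F Comp_Dom[OF eA] D.Comp_Dom[OF edge_Arr[OF e]] Dom_edge[OF e] by simp
  qed
  moreover have "is_functor L D (restrict F (Arr L))"
    by (rule is_functor_restrict)
      (auto simp: v Dom_Cod_in_Obj ev_closed[OF evF] intro!: F ev_Comp evF)
  ultimately show ?thesis
    using v by (intro exI[of _ "restrict F (Arr L)"]) (auto simp: Obj_simps)
qed

end

section \<open>The groupoid presented by the 1-skeleton\<close>

context k_graph
begin

abbreviation "Aug \<equiv> augmented Sk"
abbreviation "Rels \<equiv> cancellation_relations Sk \<union> commuting_squares k L d"

lemma augmented_simps [simp]:
  "Vert Aug = Obj L" "Edge Aug = Pos ` Edge Sk \<union> Neg ` Edge Sk"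
  "Rng Aug (Pos e) = Cod L e" "Src Aug (Pos e) = Dom L e"
  "Rng Aug (Neg e) = Dom L e" "Src Aug (Neg e) = Cod L e"
  by (simp_all add: augmented_def)

text \<open>Since \<open>e f\<close> and \<open>g h\<close> are the same morphism of
  \<open>L\<close>, the two paths share range and source, as a relation must.\<close>

lemma commuting_squareE:
  assumes "(a, b) \<in> commuting_squares k L d"
  obtains e f g h where "a = (Cod L e, [Pos e, Pos f], Dom L f)" "b = (Cod L e, [Pos g, Pos h], Dom L f)"
    "{e, f, g, h} \<subseteq> Edge Sk" "Dom L e = Cod L f" "Dom L g = Cod L h" "Comp L e f = Comp L g h"
    "Cod L g = Cod L e" "Dom L h = Dom L f"
proof -
  obtain e f g h where *: "a = (Cod L e, [Pos e, Pos f], Dom L f)" "b = (Cod L g, [Pos g, Pos h], Dom L h)"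
    "{e, f, g, h} \<subseteq> Edge Sk" "Dom L e = Cod L f" "Dom L g = Cod L h" "Comp L e f = Comp L g h"
    using assms unfolding commuting_squares_def mem_Collect_eq prod.inject
    by (elim exE conjE) (rule that)
  have A: "e \<in> Arr L" "f \<in> Arr L" "g \<in> Arr L" "h \<in> Arr L" using *(3) by auto
  have "Cod L g = Cod L e" "Dom L h = Dom L f"
    using Cod_Comp[OF A(1,2) *(4)] Cod_Comp[OF A(3,4) *(5)]
      Dom_Comp[OF A(1,2) *(4)] Dom_Comp[OF A(3,4) *(5)] *(6) by simp_all
  then show ?thesis using that[OF *(1) _ *(3-6)] *(2) by simp
qed

lemma path_relations_skeleton: "path_relations Aug Rels"
proof -
  interpret S: graph Sk by (rule graph_skeleton)
  interpret graph Aug by (rule S.graph_augmented)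
  show ?thesis
  proof
    fix v es w v' es' w' assume "((v, es, w), (v', es', w')) \<in> Rels"
    then consider "((v, es, w), (v', es', w')) \<in> cancellation_relations Sk"
      | "((v, es, w), (v', es', w')) \<in> commuting_squares k L d" by blast
    then show "is_path Aug (v, es, w) \<and> is_path Aug (v', es', w') \<and> v = v' \<and> w = w'"
    proof cases
      case 1
      then show ?thesis
        by (auto simp: cancellation_relations_def empty_path_def Dom_Cod_in_Obj)
    next
      case 2
      then show ?thesis
        by (cases rule: commuting_squareE) (auto simp: Dom_Cod_in_Obj)
    qed
  qed
qed

end

sublocale k_graph \<subseteq> P: path_relations Aug Rels
  by (rule path_relations_skeleton)

section \<open>The canonical diagram and its universal property\<close>

context k_graph
begin

abbreviation "cvert \<equiv> canonical_vert Aug Rels"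
abbreviation "cedge \<equiv> canonical_edge Aug Rels"

lemma category_Q: "category P.Q"
  by (rule P.category_quotient)

lemma canonical_vert_Obj: "v \<in> Obj L \<Longrightarrow> cvert v \<in> Obj P.Q"
  using P.canonical_vert_in[of v] unfolding Obj_def[of P.Q] canonical_vert_def
  by (simp add: P.Dom_quotient path_cat_simps empty_path_def)

lemma Comp_canonical_edge:
  assumes "x \<in> Edge Aug" "y \<in> Edge Aug" "Src Aug x = Rng Aug y"
  shows "Comp P.Q (cedge x) (cedge y) = P.cls (Rng Aug x, [x, y], Src Aug y)"
  using assms P.Src_closed P.cls_Cons[of "Rng Aug x" x "[y]" "Src Aug y"]
  by (simp add: canonical_edge_def del: augmented_simps)

lemma canonical_edge_cancel:
  assumes "x \<in> Edge Aug"
  shows "Comp P.Q (cedge (flip x)) (cedge x) = cvert (Src Aug x)"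
proof -
  have "((Src Aug x, [flip x, x], Src Aug x), empty_path (Src Aug x)) \<in> Rels"
    using assms unfolding cancellation_relations_def by blast
  then have "P.cls (Src Aug x, [flip x, x], Src Aug x) = P.cls (empty_path (Src Aug x))"
    by (intro P.cong_class_eqI congruence_closure.base)
  then show ?thesis
    using Comp_canonical_edge[of "flip x" x] assms
    by (simp add: canonical_vert_def augmented_flip del: augmented_simps)
qed

text \<open>The cancellation relation of \<open>Pos e\<close> gives one of the two identities, that
  of \<open>Neg e\<close> the other.\<close>

lemma inverse_in_canonical_edge:
  assumes "e \<in> Edge Sk"
  shows "inverse_in P.Q (cedge (Pos e)) (cedge (Neg e))"
proof -
  have E: "Pos e \<in> Edge Aug" "Neg e \<in> Edge Aug" using assms by simp_all
  show ?thesis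
    using P.canonical_edge_in[OF E(1)] P.canonical_edge_in[OF E(2)]
      P.Dom_canonical_edge[OF E(1)] P.Dom_canonical_edge[OF E(2)]
      P.Cod_canonical_edge[OF E(1)] P.Cod_canonical_edge[OF E(2)]
      canonical_edge_cancel[OF E(1)] canonical_edge_cancel[OF E(2)]
    by (simp add: inverse_in_def)
qed

lemma canonical_edge_square:
  assumes "{e, f, g, h} \<subseteq> Edge Sk" "Dom L e = Cod L f" "d e \<noteq> d f" "Dom L g = Cod L h"
    "Comp L e f = Comp L g h" "d g = d f" "d h = d e"
  shows "Comp P.Q (cedge (Pos e)) (cedge (Pos f)) = Comp P.Q (cedge (Pos g)) (cedge (Pos h))"
proof -
  have "((Cod L e, [Pos e, Pos f], Dom L f), (Cod L g, [Pos g, Pos h], Dom L h)) \<in> Rels"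
    using assms unfolding commuting_squares_def by blast
  then have "P.cls (Cod L e, [Pos e, Pos f], Dom L f) = P.cls (Cod L g, [Pos g, Pos h], Dom L h)"
    by (intro P.cong_class_eqI congruence_closure.base)
  then show ?thesis
    using assms Comp_canonical_edge[of "Pos e" "Pos f"] Comp_canonical_edge[of "Pos g" "Pos h"]
    by simp
qed

text \<open>The canonical diagram satisfies the squares, so it extends from the skeleton to all of
  \<open>L\<close>; this \<open>j\<close> is the counterpart of the inclusion
  \<open>i\<close>.\<close>

lemma ex_skeleton_functor:
  "\<exists>j. is_functor L P.Q j \<and> (\<forall>v\<in>Obj L. j v = cvert v) \<and> (\<forall>e\<in>Edge Sk. j e = cedge (Pos e))"
proof -
  interpret Q: category P.Q by (rule category_Q)
  interpret square_diagram L k d P.Q cvert "\<lambda>e. cedge (Pos e)"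
    by unfold_locales (rule canonical_edge_square canonical_vert_Obj; assumption |
        simp add: P.canonical_edge_in P.Dom_canonical_edge P.Cod_canonical_edge)+
  show ?thesis by (rule functor_extends)
qed

text \<open>Edges become invertible under \<open>j\<close>, hence so do all their composites. The
  type \<open>'x\<close> is left free so that the property can be used at the morphism types of both
  categories to be compared.\<close>

lemma is_fundamental_groupoid_skeleton:
  assumes j: "is_functor L P.Q j" and jv: "\<And>v. v \<in> Obj L \<Longrightarrow> j v = cvert v"
    and je: "\<And>e. e \<in> Edge Sk \<Longrightarrow> j e = cedge (Pos e)"
  shows "is_fundamental_groupoid TYPE('x) L P.Q j"
proof -
  interpret Q: category P.Q by (rule category_Q)
  have j_inv: "invertible_in P.Q (j a)" if "a \<in> Arr L" for a
    using that
  proof (induction rule: arr_induct)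
    case (vert v)
    then show ?case using jv Q.invertible_Obj[OF canonical_vert_Obj] by simp
  next
    case (edge e b)
    have eA: "e \<in> Arr L" using edge by simp
    have "invertible_in P.Q (j e)"
      using inverse_in_canonical_edge je edge(1) by (auto simp: invertible_in_iff)
    moreover have "Dom P.Q (j e) = Cod P.Q (j b)"
      using is_functorD(2)[OF j eA] is_functorD(3)[OF j edge(2)] edge(3) by simp
    ultimately show ?case
      using Q.invertible_Comp[OF _ edge(4)] is_functorD(4)[OF j eA edge(2,3)] by simp
  qed
  have univ_ex: "\<exists>F'. is_functor P.Q D F' \<and> (\<forall>a\<in>Arr L. F' (j a) = F a)"
    if D: "category D" and F: "is_functor L D F" and F_inv: "\<And>a. a \<in> Arr L \<Longrightarrow> invertible_in D (F a)"
    for D :: "'x cat" and F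
  proof -
    interpret D: category D by (rule D)
    \<comment> \<open>\<open>J\<close> chooses inverses in \<open>D\<close>; it prescribes the
      images of the negative edges.\<close>
    obtain J where J: "\<And>a. a \<in> Arr L \<Longrightarrow> inverse_in D (F a) (J a)"
      using F_inv unfolding invertible_in_iff by metis
    have F_obj: "F v \<in> Obj D" if "v \<in> Obj L" for v
      using is_functorD(1,2)[OF F, of v] Obj_simps[OF that] by (simp add: Obj_def)
    \<comment> \<open>\<open>path_eval\<close> ends every path with the value of its source vertex;
      these equations absorb that last factor.\<close>
    have FD: "Comp D (F a) (F (Dom L a)) = F a" "Comp D (J a) (F (Cod L a)) = J a"
      if "a \<in> Arr L" for a
      using D.Comp_Dom[of "F a"] D.Comp_Dom[of "J a"] is_functorD(1-3)[OF F that] J[OF that]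
      by (auto simp: inverse_in_def)
    have sat: "path_eval D F (case_signed F J) a = path_eval D F (case_signed F J) b"
      if "(a, b) \<in> Rels" for a b
    proof (cases "(a, b) \<in> cancellation_relations Sk")
      case True
      then obtain x where x: "x \<in> Edge Aug" "a = (Src Aug x, [flip x, x], Src Aug x)"
        "b = empty_path (Src Aug x)"
        unfolding cancellation_relations_def by blast
      then show ?thesis
        using FD J is_functorD(2,3)[OF F] by (auto simp: empty_path_def inverse_in_def)
    next
      case False
      then have "(a, b) \<in> commuting_squares k L d" using that by simp
      then show ?thesis
      proof (cases rule: commuting_squareE)
        case (1 e f g h)
        then have A: "e \<in> Arr L" "f \<in> Arr L" "g \<in> Arr L" "h \<in> Arr L" by auto
        have "Comp D (F e) (F f) = Comp D (F g) (F h)"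
          using is_functorD(4)[OF F, of e f] is_functorD(4)[OF F, of g h] 1 A by simp
        then show ?thesis using FD(1)[OF A(2)] FD(1)[OF A(4)] 1 by simp
      qed
    qed
    have "\<exists>F'. is_functor P.Q D F' \<and> (\<forall>v\<in>Vert Aug. F' (cvert v) = F v) \<and>
        (\<forall>x\<in>Edge Aug. F' (cedge x) = case_signed F J x)"
      by (rule P.functor_exists[OF D _ _ sat])
        (use F_obj J is_functorD(1-3)[OF F] in \<open>auto simp: inverse_in_def\<close>)
    then obtain F' where F': "is_functor P.Q D F'" "\<And>v. v \<in> Obj L \<Longrightarrow> F' (cvert v) = F v"
      "\<And>e. e \<in> Edge Sk \<Longrightarrow> F' (cedge (Pos e)) = F e"
      by auto
    \<comment> \<open>\<open>F'\<close> was prescribed only on vertices and edges, and functors on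
      \<open>L\<close> are determined there.\<close>
    have "compose (Arr L) F' j = F"
      by (rule functor_skeleton_eqI[OF is_functor_compose[OF j F'(1)] F])
        (simp_all add: compose_def jv je F' Obj_simps)
    then show ?thesis using F'(1) by (metis compose_eq)
  qed
  have univ_unique: "F1 = F2"
    if D: "category D" and 1: "is_functor P.Q D F1" and 2: "is_functor P.Q D F2"
      and eq: "\<And>a. a \<in> Arr L \<Longrightarrow> F1 (j a) = F2 (j a)"
    for D :: "'x cat" and F1 F2
  proof (rule P.functor_eqI[OF 1 2])
    interpret D: category D by (rule D)
    show "F1 (cvert v) = F2 (cvert v)" if "v \<in> Vert Aug" for v
      using eq[of v] that jv[of v] by (simp add: Obj_simps)
    have pos: "F1 (cedge (Pos e)) = F2 (cedge (Pos e))" if "e \<in> Edge Sk" for e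
      using eq[of e] that je[of e] by simp
    \<comment> \<open>Functors preserve inverses, and inverses in \<open>D\<close> are unique, so
      agreement on positive edges forces agreement on negative ones.\<close>
    have neg: "F1 (cedge (Neg e)) = F2 (cedge (Neg e))" if "e \<in> Edge Sk" for e
      using D.inverse_in_unique inverse_in_functor[OF 1 inverse_in_canonical_edge[OF that]]
        inverse_in_functor[OF 2 inverse_in_canonical_edge[OF that]] pos[OF that] by metis
    show "F1 (cedge x) = F2 (cedge x)" if "x \<in> Edge Aug" for x
      using that pos neg by auto
  qed
  show ?thesis
    unfolding is_fundamental_groupoid_def
  proof (intro conjI allI impI ballI; (elim conjE)?)
    fix D :: "'x cat" and F
    assume "category D" "is_functor L D F" "\<forall>a\<in>Arr L. invertible_in D (F a)"
    then show "\<exists>!F'. is_functor P.Q D F' \<and> (\<forall>a\<in>Arr L. F' (j a) = F a)"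
      using univ_ex[of D F] univ_unique[of D] by (intro ex_ex1I) auto
  qed (use category_Q j j_inv in auto)
qed

end

section \<open>Comparison of the fundamental groupoid with the presented category\<close>

theorem theorem5p5:
  fixes L :: "'a cat" and d :: "'a \<Rightarrow> nat \<Rightarrow> nat" and k :: nat
    and G :: "'g cat" and i :: "'a \<Rightarrow> 'g"
    and E :: "('a, 'a) graph" and S C :: "(('a, 'a signed) path \<times> ('a, 'a signed) path) set"
  assumes "k_graph L k d"
    and "E = skeleton k L d"
    and "S = commuting_squares k L d"
    and "C = cancellation_relations E"
    and "is_fundamental_groupoid TYPE('g) L G i"
    and "is_fundamental_groupoid TYPE(('a, 'a signed) path set) L G i"
  shows "\<exists>!T. is_isomorphism G (path_cat_mod (augmented E) (C \<union> S)) T \<and>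
      (\<forall>v\<in>Vert E. T (i v) = canonical_vert (augmented E) (C \<union> S) v) \<and>
      (\<forall>e\<in>Edge E. T (i e) = canonical_edge (augmented E) (C \<union> S) (Pos e))"
proof -
  interpret k_graph L k d by fact
  note E = assms(2) and S = assms(3) and C = assms(4)[unfolded E]
  note G = is_fundamental_groupoidD[OF assms(6)]
  obtain j where j: "is_functor L P.Q j" "\<And>v. v \<in> Obj L \<Longrightarrow> j v = cvert v"
    "\<And>e. e \<in> Edge Sk \<Longrightarrow> j e = cedge (Pos e)"
    using ex_skeleton_functor by blast
  note Q = is_fundamental_groupoid_skeleton[OF j]
  \<comment> \<open>Agreement on the skeleton is the same as \<open>T\<close> carrying
    \<open>i\<close> to \<open>j\<close> on all of \<open>L\<close>, which is the form that the
    universal properties speak about.\<close>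
  have iff: "is_isomorphism G P.Q T \<and>
      (\<forall>v\<in>Obj L. T (i v) = cvert v) \<and> (\<forall>e\<in>Edge Sk. T (i e) = cedge (Pos e)) \<longleftrightarrow>
      is_isomorphism G P.Q T \<and> (\<forall>a\<in>Arr L. T (i a) = j a)" for T
  proof (intro conj_cong refl iffI)
    assume "is_isomorphism G P.Q T"
      and eq: "(\<forall>v\<in>Obj L. T (i v) = cvert v) \<and> (\<forall>e\<in>Edge Sk. T (i e) = cedge (Pos e))"
    then have T: "is_functor G P.Q T" by (simp add: is_isomorphism_def)
    have "compose (Arr L) T i = j"
      by (rule functor_skeleton_eqI[OF is_functor_compose[OF G(2) T] j(1)])
        (use eq in \<open>auto simp: compose_def j Obj_simps\<close>)
    then show "\<forall>a\<in>Arr L. T (i a) = j a" by (metis compose_eq)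
  qed (use j in \<open>auto simp: Obj_simps\<close>)
  have "\<exists>T. is_isomorphism G P.Q T \<and> (\<forall>a\<in>Arr L. T (i a) = j a)"
    by (rule fundamental_groupoid_unique[OF assms(5,6) Q Q])
  \<comment> \<open>Uniqueness already holds among all functors under \<open>L\<close>, hence among
    isomorphisms.\<close>
  moreover have "\<exists>!T. is_functor G P.Q T \<and> (\<forall>a\<in>Arr L. T (i a) = j a)"
    by (rule G(4)[OF is_fundamental_groupoidD(1-3)[OF Q]])
  ultimately have "\<exists>!T. is_isomorphism G P.Q T \<and> (\<forall>a\<in>Arr L. T (i a) = j a)"
    unfolding is_isomorphism_def by blast
  then show ?thesis unfolding E S C skeleton_simps(1) iff .
qed

end
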